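(* Suppose $n$ is odd. Then the signed cardinality statistic on $\mathcal{IC}([2]\times[n])$ is $0$-mesic with respect to rowmotion, i.e., for every rowmotion orbit $\mathcal{O}$, $\frac{1}{|\mathcal{O}|}\sum_{I\in\mathcal{O}}\mathrm{sc}(I)=0$.
   Context: $[2]\times[n]=\{(i,j): i\in\{1,2\},1\le j\le n\}$ with the componentwise order. An interval-closed set (ICS) is a subset $I$ with $x,y\in I$, $x\le z\le y\Rightarrow z\in I$; $\mathcal{IC}(P)$ is the set of ICS. The toggle $t_x$ sends $I$ to $I\triangle\{x\}$ if this is an ICS, and to $I$ otherwise. Rowmotion is $\mathrm{Row}=t_{x_1}\circ\cdots\circ t_{x_N}$ for any linear extension $x_1,\dots,x_N$ of the poset (toggles applied top to bottom). The rank of $(i,j)$ is $i+j-2$; $\mathrm{sc}(x)=1$ if the rank of $x$ is even and $-1$ if it is odd, and $\mathrm{sc}(I)=\sum_{x\in I}\mathrm{sc}(x)$. *)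

theory Defs
  imports Complex_Main "HOL-Library.Product_Order" "HOL-Combinatorics.Orbits"
begin

(* The order on pairs is the componentwise one, from HOL-Library.Product_Order. *)

definition two_by :: "nat \<Rightarrow> (nat \<times> nat) set" where
  "two_by n = {1, 2} \<times> {1..n}"

definition interval_closed_sets :: "'a::order set \<Rightarrow> 'a set set" where
  "interval_closed_sets P =
     {I. I \<subseteq> P \<and> (\<forall>x\<in>I. \<forall>y\<in>I. \<forall>z\<in>P. x \<le> z \<and> z \<le> y \<longrightarrow> z \<in> I)}"

definition toggle :: "'a::order set \<Rightarrow> 'a \<Rightarrow> 'a set \<Rightarrow> 'a set" where
  "toggle P x I =
     (if sym_diff I {x} \<in> interval_closed_sets P then sym_diff I {x} else I)"

definition linear_extension :: "'a::order set \<Rightarrow> 'a list \<Rightarrow> bool" where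
  "linear_extension P xs \<longleftrightarrow>
     distinct xs \<and> set xs = P \<and>
     (\<forall>i < length xs. \<forall>j < length xs. xs ! i < xs ! j \<longrightarrow> i < j)"

(* For xs = [x1, ..., xN] this is t_x1 o ... o t_xN: the last (topmost) element
   of the list is toggled first. *)
definition rowmotion :: "'a::order set \<Rightarrow> 'a list \<Rightarrow> 'a set \<Rightarrow> 'a set" where
  "rowmotion P xs = foldr (toggle P) xs"

(* "orbit f x" is {f x, f (f x), ...}; for a bijection f of a finite set S and
   x in S it is the usual orbit of x, in particular finite and containing x. *)
definition homomesic ::
  "'a set \<Rightarrow> ('a \<Rightarrow> 'a) \<Rightarrow> ('a \<Rightarrow> real) \<Rightarrow> real \<Rightarrow> bool" where
  "homomesic S f stat c \<longleftrightarrow>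
     (\<forall>Orb \<in> orbit f ` S. 1 / real (card Orb) * (\<Sum>x\<in>Orb. stat x) = c)"

(* The subtraction does not truncate: coordinates in two_by n are at least 1. *)
definition rank :: "nat \<times> nat \<Rightarrow> nat" where
  "rank x = fst x + snd x - 2"

definition sc_elem :: "nat \<times> nat \<Rightarrow> int" where
  "sc_elem x = (if even (rank x) then 1 else -1)"

definition sc :: "(nat \<times> nat) set \<Rightarrow> int" where
  "sc I = (\<Sum>x\<in>I. sc_elem x)"

end

(* Each of the two rows of an interval-closed set is an interval, so a set is given by the four
   endpoints (a, b, c, d) of its rows [a, b] and [c, d], and rowmotion is an explicit map on these.
   The signed cardinality only depends on the parities of the endpoints, and a typical rowmotion step
   raises all four endpoints by one, which flips its sign; only the steps at which an endpoint reaches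
   the boundary or another endpoint matter. We exhibit a potential on interval-closed sets whose
   increment under rowmotion is the signed cardinality, so every orbit sum telescopes to 0.
   On the orbits avoiding empty rows the potential depends on parities only (and on whether a <= d).
   The other orbits return to sets with empty second row; there the return map is a rotation of the
   triple (a, b - a + 1, n - b + 4) with corrections when its middle entry is at most 3, and these
   corrections are paid for by the function phi below. *)

theory Submission
  imports Defs
begin

subsection \<open>Toggles and rowmotion on a poset\<close>

lemma toggle_closed: "I \<in> interval_closed_sets P \<Longrightarrow> toggle P x I \<in> interval_closed_sets P"
  by (simp add: toggle_def)

lemma toggle_involution:
  assumes "I \<in> interval_closed_sets P"
  shows "toggle P x (toggle P x I) = I"
proof -
  have "sym_diff (sym_diff I {x}) {x} = I" by auto
  then show ?thesis using assms by (auto simp: toggle_def)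
qed

lemma foldr_toggle_closed:
  "I \<in> interval_closed_sets P \<Longrightarrow> foldr (toggle P) ys I \<in> interval_closed_sets P"
  by (induction ys) (auto intro: toggle_closed)

text \<open>Each toggle is an involution on interval-closed sets, so the outermost one can be
  undone.\<close>

lemma inj_on_foldr_toggle: "inj_on (foldr (toggle P) ys) (interval_closed_sets P)"
proof (induction ys)
  case (Cons y ys)
  show ?case
  proof (rule inj_onI)
    fix I J
    assume I: "I \<in> interval_closed_sets P" and J: "J \<in> interval_closed_sets P"
      and eq: "foldr (toggle P) (y # ys) I = foldr (toggle P) (y # ys) J"
    have "foldr (toggle P) ys I = toggle P y (foldr (toggle P) (y # ys) I)"
      using toggle_involution[OF foldr_toggle_closed[OF I]] by simp
    also have "\<dots> = foldr (toggle P) ys J"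
      unfolding eq using toggle_involution[OF foldr_toggle_closed[OF J]] by simp
    finally show "I = J" using inj_onD[OF Cons] I J by blast
  qed
qed simp

text \<open>When rowmotion reaches \<open>x\<close>, the elements above \<open>x\<close> are already those of the new set \<open>J\<close> and the
elements below \<open>x\<close> still those of the old set \<open>I\<close>. The toggle at \<open>x\<close> has no effect iff \<open>x\<close> is blocked;
elements incomparable to \<open>x\<close> are irrelevant, whence the independence of the linear extension.\<close>

definition blocked :: "'a::order set \<Rightarrow> 'a set \<Rightarrow> 'a set \<Rightarrow> 'a \<Rightarrow> bool" where
  "blocked P I J x \<longleftrightarrow>
     (if x \<in> I then (\<exists>y\<in>I. y < x) \<and> (\<exists>y\<in>J. x < y)
      else (\<exists>y\<in>J. \<exists>z\<in>P. x < z \<and> z < y \<and> z \<notin> J) \<or> (\<exists>y\<in>I. \<exists>z\<in>P. y < z \<and> z < x \<and> z \<notin> I))"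

text \<open>A new violation must involve \<open>x\<close>: as the middle of a chain if
  \<open>x\<close> is removed, as one end of it if \<open>x\<close> is added.\<close>

lemma toggle_closed_iff_not_blocked:
  assumes K: "K \<in> interval_closed_sets P" and x: "x \<in> P"
  shows "sym_diff K {x} \<in> interval_closed_sets P \<longleftrightarrow> \<not> blocked P K K x"
proof -
  have sub: "K \<subseteq> P" and convex: "\<And>u v w. u \<in> K \<Longrightarrow> v \<in> K \<Longrightarrow> w \<in> P \<Longrightarrow> u \<le> w \<Longrightarrow> w \<le> v \<Longrightarrow> w \<in> K"
    using K unfolding interval_closed_sets_def by blast+
  show ?thesis
  proof (cases "x \<in> K")
    case True
    have *: "sym_diff K {x} = K - {x}" using True by auto
    have "K - {x} \<in> interval_closed_sets P \<longleftrightarrow>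
      (\<forall>u\<in>K - {x}. \<forall>v\<in>K - {x}. \<not> (u \<le> x \<and> x \<le> v))" (is "?L \<longleftrightarrow> ?R")
    proof
      assume L: ?L
      have "\<not> (u \<le> x \<and> x \<le> v)" if "u \<in> K - {x}" "v \<in> K - {x}" for u v
        using L x that unfolding interval_closed_sets_def by blast
      then show ?R by blast
    next
      assume R: ?R
      have "w \<in> K - {x}" if "u \<in> K - {x}" "v \<in> K - {x}" "w \<in> P" "u \<le> w" "w \<le> v" for u v w
        using convex[of u v w] R that by blast
      then show ?L using sub unfolding interval_closed_sets_def by blast
    qed
    also have "\<dots> \<longleftrightarrow> \<not> blocked P K K x"
      using True by (auto simp: blocked_def order_less_le)
    finally show ?thesis unfolding * .
  next
    case False
    have *: "sym_diff K {x} = insert x K" using False by auto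
    show ?thesis unfolding *
    proof
      assume L: "insert x K \<in> interval_closed_sets P"
      have conv: "w \<in> insert x K" if "u \<in> insert x K" "v \<in> insert x K" "w \<in> P" "u \<le> w" "w \<le> v" for u v w
        using L that unfolding interval_closed_sets_def by blast
      have "\<not> (\<exists>y\<in>K. \<exists>z\<in>P. x < z \<and> z < y \<and> z \<notin> K)"
        using conv[OF insertI1 insertI2] less_imp_le by blast
      moreover have "\<not> (\<exists>y\<in>K. \<exists>z\<in>P. y < z \<and> z < x \<and> z \<notin> K)"
        using conv[OF insertI2 insertI1] less_imp_le by blast
      ultimately show "\<not> blocked P K K x"
        using False by (simp only: blocked_def if_False simp_thms)
    next
      assume "\<not> blocked P K K x"
      then have up: "\<not> (\<exists>y\<in>K. \<exists>z\<in>P. x < z \<and> z < y \<and> z \<notin> K)"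
        and down: "\<not> (\<exists>y\<in>K. \<exists>z\<in>P. y < z \<and> z < x \<and> z \<notin> K)"
        using False by (simp_all only: blocked_def if_False de_Morgan_disj simp_thms)
      have "w \<in> insert x K" if w: "u \<in> insert x K" "v \<in> insert x K" "w \<in> P" "u \<le> w" "w \<le> v" for u v w
      proof (rule ccontr)
        assume w': "w \<notin> insert x K"
        then have "u \<noteq> w" "w \<noteq> v" using w by auto
        then have uw: "u < w" "w < v" using w by auto
        consider "u \<in> K" "v \<in> K" | "u = x" "v \<in> K" | "u \<in> K" "v = x" | "u = x" "v = x"
          using w by blast
        then show False
        proof cases
          case 1 then show ?thesis using convex w w' by blast
        next
          case 2 then show ?thesis using up uw w(3) w' by blast
        next
          case 3 then show ?thesis using down uw w(3) w' by blast
        next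
          case 4 then show ?thesis using uw by simp
        qed
      qed
      then show "insert x K \<in> interval_closed_sets P"
        using sub x unfolding interval_closed_sets_def by blast
    qed
  qed
qed

lemma blocked_cong:
  assumes below: "\<And>y. y \<in> P \<Longrightarrow> y \<le> x \<Longrightarrow> y \<in> K \<longleftrightarrow> y \<in> I"
    and above: "\<And>y. y \<in> P \<Longrightarrow> x < y \<Longrightarrow> y \<in> K \<longleftrightarrow> y \<in> J"
    and sub: "K \<subseteq> P" "I \<subseteq> P" "J \<subseteq> P" and x: "x \<in> P"
  shows "blocked P K K x \<longleftrightarrow> blocked P I J x"
proof -
  have lower: "{y \<in> K. y < x} = {y \<in> I. y < x}" and upper: "{y \<in> K. x < y} = {y \<in> J. x < y}"
    using sub below above by (auto dest: less_imp_le)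
  have "x \<in> K \<longleftrightarrow> x \<in> I" using below x by blast
  moreover have "(\<exists>y\<in>K. y < x) \<longleftrightarrow> (\<exists>y\<in>I. y < x)" using lower by blast
  moreover have "(\<exists>y\<in>K. x < y) \<longleftrightarrow> (\<exists>y\<in>J. x < y)" using upper by blast
  moreover have "(\<exists>z\<in>P. x < z \<and> z < y \<and> z \<notin> K) \<longleftrightarrow> (\<exists>z\<in>P. x < z \<and> z < y \<and> z \<notin> J)" for y
    using above by blast
  then have "(\<exists>y\<in>K. \<exists>z\<in>P. x < z \<and> z < y \<and> z \<notin> K) \<longleftrightarrow> (\<exists>y\<in>J. \<exists>z\<in>P. x < z \<and> z < y \<and> z \<notin> J)"
    using upper by (smt (verit, best) less_trans mem_Collect_eq)
  moreover have "(\<exists>z\<in>P. y < z \<and> z < x \<and> z \<notin> K) \<longleftrightarrow> (\<exists>z\<in>P. y < z \<and> z < x \<and> z \<notin> I)" for y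
    using below less_imp_le by blast
  then have "(\<exists>y\<in>K. \<exists>z\<in>P. y < z \<and> z < x \<and> z \<notin> K) \<longleftrightarrow> (\<exists>y\<in>I. \<exists>z\<in>P. y < z \<and> z < x \<and> z \<notin> I)"
    using lower by (smt (verit, best) less_trans mem_Collect_eq)
  ultimately show ?thesis by (simp add: blocked_def)
qed

lemma rowmotion_eqI:
  assumes ext: "linear_extension P xs" and I: "I \<in> interval_closed_sets P" and "J \<subseteq> P"
    and J: "\<And>x. x \<in> P \<Longrightarrow> x \<in> J \<longleftrightarrow> (x \<in> I \<longleftrightarrow> blocked P I J x)"
  shows "rowmotion P xs I = J"
proof -
  \<comment> \<open>The toggles applied so far form a suffix of \<open>xs\<close>; on it the set
    already agrees with \<open>J\<close>, elsewhere still with \<open>I\<close>. This suffix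
    contains everything above the next element \<open>x\<close> and nothing at or below
    \<open>x\<close>.\<close>
  have suffix: "foldr (toggle P) ys I = (J \<inter> set ys) \<union> (I - set ys)" if "xs = zs @ ys" for zs ys
    using that
  proof (induction ys arbitrary: zs)
    case (Cons x ys)
    define K where "K = foldr (toggle P) ys I"
    have K_eq: "K = (J \<inter> set ys) \<union> (I - set ys)"
      using Cons.IH[of "zs @ [x]"] Cons.prems by (simp add: K_def)
    have K: "K \<in> interval_closed_sets P" using I by (simp add: K_def foldr_toggle_closed)
    have dist: "distinct xs" and P: "set xs = P"
      and mono: "\<And>i j. i < length xs \<Longrightarrow> j < length xs \<Longrightarrow> xs ! i < xs ! j \<Longrightarrow> i < j"
      using ext by (auto simp: linear_extension_def)
    have x: "x \<in> P" "x \<notin> set ys" using Cons.prems P dist by auto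
    have x_nth: "xs ! length zs = x" "length zs < length xs" using Cons.prems by auto
    have above: "y \<in> set ys" if y: "y \<in> P" "x < y" for y
    proof -
      obtain j where j: "j < length xs" "xs ! j = y" using y P by (metis in_set_conv_nth)
      then have "length zs < j" using mono[of "length zs" j] x_nth y by simp
      then have "y = ys ! (j - Suc (length zs))" "j - Suc (length zs) < length ys"
        using j Cons.prems by (auto simp: nth_append nth_Cons')
      then show ?thesis by simp
    qed
    have below: "y \<notin> set ys" if "y \<le> x" for y
    proof
      assume y: "y \<in> set ys"
      then have "y < x" using that x by (metis order.not_eq_order_implies_strict)
      obtain j where j: "j < length ys" "ys ! j = y" using y by (metis in_set_conv_nth)
      have "xs ! (Suc (length zs) + j) = y" using Cons.prems j by (simp add: nth_append)
      then show False
        using mono[of "Suc (length zs) + j" "length zs"] x_nth \<open>y < x\<close> j Cons.prems by simp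
    qed
    have "K \<subseteq> P" "I \<subseteq> P" using K I by (auto simp: interval_closed_sets_def)
    moreover have "y \<in> K \<longleftrightarrow> y \<in> I" if "y \<in> P" "y \<le> x" for y
      using below[OF that(2)] by (simp add: K_eq)
    moreover have "y \<in> K \<longleftrightarrow> y \<in> J" if "y \<in> P" "x < y" for y
      using above[OF that] by (simp add: K_eq)
    ultimately have "blocked P K K x \<longleftrightarrow> blocked P I J x"
      using blocked_cong[of P x K I J] \<open>J \<subseteq> P\<close> x by blast
    then have "x \<in> toggle P x K \<longleftrightarrow> x \<in> J"
      using toggle_closed_iff_not_blocked[OF K x(1)] J[OF x(1)] x(2)
      by (auto simp: toggle_def K_eq)
    moreover have "toggle P x K - {x} = K - {x}" by (auto simp: toggle_def)
    ultimately show ?case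
      using x(2) unfolding foldr.simps comp_def K_def[symmetric]
      by (auto simp: K_eq)
  qed simp
  then have "rowmotion P xs I = (J \<inter> set xs) \<union> (I - set xs)"
    using suffix[of "[]" xs] by (simp add: rowmotion_def)
  moreover have "set xs = P" "I \<subseteq> P"
    using ext I by (auto simp: linear_extension_def interval_closed_sets_def)
  ultimately show ?thesis using \<open>J \<subseteq> P\<close> by auto
qed

text \<open>An injective self-map of a finite set permutes each orbit, so the potential has the same
  orbit sum before and after the map and the increments cancel.\<close>

lemma homomesic_zero_if_coboundary:
  fixes stat pot :: "'a set \<Rightarrow> real"
  assumes "finite S" "inj_on f S" "f ` S \<subseteq> S"
    and pot: "\<And>I. I \<in> S \<Longrightarrow> stat I = pot (f I) - pot I"
  shows "homomesic S f stat 0"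
  unfolding homomesic_def
proof
  fix Orb assume "Orb \<in> orbit f ` S"
  then obtain I where I: "I \<in> S" "Orb = orbit f I" by auto
  have "J \<in> S" if "J \<in> orbit f I" for J
    using that by induction (use assms I in auto)
  then have sub: "Orb \<subseteq> S" using I by auto
  note fin = finite_subset[OF sub assms(1)] and inj = inj_on_subset[OF assms(2) sub]
  have "f ` Orb \<subseteq> Orb" using I by (auto intro: orbit.step)
  then have "f ` Orb = Orb" using fin inj by (simp add: endo_inj_surj)
  then have "(\<Sum>J\<in>Orb. pot (f J)) = (\<Sum>J\<in>Orb. pot J)"
    using sum.reindex[OF inj, of pot] by simp
  moreover have "(\<Sum>J\<in>Orb. stat J) = (\<Sum>J\<in>Orb. pot (f J) - pot J)"
    using sub pot by (intro sum.cong) auto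
  ultimately show "1 / real (card Orb) * (\<Sum>J\<in>Orb. stat J) = 0"
    by (simp add: sum_subtractf)
qed

subsection \<open>Interval-closed sets of a product of two chains\<close>

text \<open>Empty rows have a canonical encoding: \<open>(n + 1, n)\<close> for the first row and \<open>(1, 0)\<close> for the second one.
With these choices the constraints \<open>c \<le> a\<close> and \<open>d \<le> b\<close> hold for empty rows as well.\<close>

definition admissible :: "int \<Rightarrow> int \<Rightarrow> int \<Rightarrow> int \<Rightarrow> int \<Rightarrow> bool" where
  "admissible n a b c d \<longleftrightarrow>
     1 \<le> c \<and> c \<le> a \<and> d \<le> b \<and> b \<le> n \<and>
     (c \<le> d \<or> c = 1 \<and> d = 0) \<and> (a \<le> b \<or> a = n + 1 \<and> b = n)"

definition two_rows :: "int \<Rightarrow> int \<Rightarrow> int \<Rightarrow> int \<Rightarrow> (nat \<times> nat) set" where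
  "two_rows a b c d = {1} \<times> {j. a \<le> int j \<and> int j \<le> b} \<union> {2} \<times> {j. c \<le> int j \<and> int j \<le> d}"

lemma mem_two_rows [simp]:
  "(i, j) \<in> two_rows a b c d \<longleftrightarrow> i = 1 \<and> a \<le> int j \<and> int j \<le> b \<or> i = 2 \<and> c \<le> int j \<and> int j \<le> d"
  by (auto simp: two_rows_def)

lemma mem_two_by [simp]: "(i, j) \<in> two_by n \<longleftrightarrow> (i = 1 \<or> i = 2) \<and> 1 \<le> j \<and> j \<le> n"
  by (auto simp: two_by_def)

lemma less_pair_iff [simp]: "(i, j) < (k, l) \<longleftrightarrow> i \<le> k \<and> j \<le> l \<and> (i, j) \<noteq> (k, l)"
  for i j k l :: nat
  by (auto simp: less_prod_def)

lemma two_rows_subset: "admissible (int n) a b c d \<Longrightarrow> two_rows a b c d \<subseteq> two_by n"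
  by (auto simp: admissible_def)

lemma two_rows_closed:
  assumes "admissible (int n) a b c d"
  shows "two_rows a b c d \<in> interval_closed_sets (two_by n)"
  using two_rows_subset[OF assms] assms by (auto simp: interval_closed_sets_def admissible_def)

lemma interval_closed_set_is_two_rows:
  assumes I: "I \<in> interval_closed_sets (two_by n)"
  obtains a b c d where "admissible (int n) a b c d" "I = two_rows a b c d"
proof -
  have sub: "I \<subseteq> two_by n"
    and convex: "\<And>u v w. u \<in> I \<Longrightarrow> v \<in> I \<Longrightarrow> w \<in> two_by n \<Longrightarrow> u \<le> w \<Longrightarrow> w \<le> v \<Longrightarrow> w \<in> I"
    using I unfolding interval_closed_sets_def by blast+
  define A where "A = {j. (1, j) \<in> I}"
  define B where "B = {j. (2, j) \<in> I}"
  have bounds: "A \<subseteq> {1..n}" "B \<subseteq> {1..n}" using sub by (auto simp: A_def B_def)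
  then have fin: "finite A" "finite B" by (auto intro: finite_subset)
  have I_eq: "I = {1} \<times> A \<union> {2} \<times> B" using sub by (auto simp: A_def B_def)
  have A_interval: "A = {Min A..Max A}" if "A \<noteq> {}"
  proof
    show "A \<subseteq> {Min A..Max A}" using fin by auto
    show "{Min A..Max A} \<subseteq> A"
    proof
      fix j assume j: "j \<in> {Min A..Max A}"
      have m: "Min A \<in> A" "Max A \<in> A" using fin that by auto
      then have "1 \<le> Min A" "Max A \<le> n" using bounds(1) by (meson atLeastAtMost_iff subsetD)+
      then show "j \<in> A"
        using convex[of "(1, Min A)" "(1, Max A)" "(1, j)"] m j by (simp add: A_def)
    qed
  qed
  have B_interval: "B = {Min B..Max B}" if "B \<noteq> {}"
  proof
    show "B \<subseteq> {Min B..Max B}" using fin by auto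
    show "{Min B..Max B} \<subseteq> B"
    proof
      fix j assume j: "j \<in> {Min B..Max B}"
      have m: "Min B \<in> B" "Max B \<in> B" using fin that by auto
      then have "1 \<le> Min B" "Max B \<le> n" using bounds(2) by (meson atLeastAtMost_iff subsetD)+
      then show "j \<in> B"
        using convex[of "(2, Min B)" "(2, Max B)" "(2, j)"] m j by (simp add: B_def)
    qed
  qed
  obtain a b where ab: "A = {j. a \<le> int j \<and> int j \<le> b}"
    "a = int n + 1 \<and> b = int n \<or> 1 \<le> a \<and> a \<le> b \<and> b \<le> int n \<and> nat a \<in> A \<and> nat b \<in> A"
  proof (cases "A = {}")
    case True
    then show ?thesis using that[of "int n + 1" "int n"] by auto
  next
    case False
    have m: "Min A \<in> A" "Max A \<in> A" using fin False by auto
    moreover have "1 \<le> Min A" "Max A \<le> n" using m bounds(1) by (meson atLeastAtMost_iff subsetD)+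
    moreover have "Min A \<le> Max A" using fin m by simp
    moreover have "A = {j. int (Min A) \<le> int j \<and> int j \<le> int (Max A)}"
      by (subst A_interval[OF False]) auto
    ultimately show ?thesis using that[of "int (Min A)" "int (Max A)"] by simp
  qed
  obtain c d where cd: "B = {j. c \<le> int j \<and> int j \<le> d}"
    "c = 1 \<and> d = 0 \<or> 1 \<le> c \<and> c \<le> d \<and> d \<le> int n \<and> nat c \<in> B \<and> nat d \<in> B"
  proof (cases "B = {}")
    case True
    show ?thesis by (rule that[of 1 0]) (auto simp: True)
  next
    case False
    have m: "Min B \<in> B" "Max B \<in> B" using fin False by auto
    moreover have "1 \<le> Min B" "Max B \<le> n" using m bounds(2) by (meson atLeastAtMost_iff subsetD)+
    moreover have "Min B \<le> Max B" using fin m by simp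
    moreover have "B = {j. int (Min B) \<le> int j \<and> int j \<le> int (Max B)}"
      by (subst B_interval[OF False]) auto
    ultimately show ?thesis using that[of "int (Min B)" "int (Max B)"] by simp
  qed
  \<comment> \<open>By the default values of empty rows only two nonempty rows can violate this;
    then \<open>(2, nat a)\<close> lies between \<open>(1, nat a)\<close> and
    \<open>(2, nat c)\<close>.\<close>
  have "c \<le> a"
  proof (rule ccontr)
    assume "\<not> c \<le> a"
    then have *: "1 \<le> a" "a \<le> n" "a < c" "nat a \<in> A" "nat c \<in> B" using ab(2) cd(2) by auto
    then have "1 \<le> nat a" "nat a \<le> n" "nat a \<le> nat c" by linarith+
    with * have "nat a \<in> B"
      using convex[of "(1, nat a)" "(2, nat c)" "(2, nat a)"] by (simp add: A_def B_def)
    then show False using * cd(1) by simp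
  qed
  \<comment> \<open>Dually, \<open>(1, nat d)\<close> lies between \<open>(1, nat b)\<close> and
    \<open>(2, nat d)\<close>.\<close>
  moreover have "d \<le> b"
  proof (rule ccontr)
    assume "\<not> d \<le> b"
    then have *: "a \<le> b" "1 \<le> b" "d \<le> n" "b < d" "nat b \<in> A" "nat d \<in> B" using ab(2) cd(2) by auto
    then have "1 \<le> nat d" "nat d \<le> n" "nat b \<le> nat d" by linarith+
    with * have "nat d \<in> A"
      using convex[of "(1, nat b)" "(2, nat d)" "(1, nat d)"] by (simp add: A_def B_def)
    then show False using * ab(1) by simp
  qed
  ultimately have "admissible (int n) a b c d" using ab(2) cd(2) by (auto simp: admissible_def)
  moreover have "I = two_rows a b c d" unfolding I_eq two_rows_def ab(1) cd(1) ..
  ultimately show ?thesis by (rule that)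
qed

text \<open>Intervals of naturals do not see negative endpoints, hence the sign conditions. The
  second interval inherits nonemptiness from the first.\<close>

lemma interval_inj:
  assumes "{j. a \<le> int j \<and> int j \<le> b} = {j. a' \<le> int j \<and> int j \<le> b'}"
    and "0 \<le> a" "0 \<le> a'" "a \<le> b"
  shows "a = a' \<and> b = b'"
proof -
  have mem: "a \<le> int j \<and> int j \<le> b \<longleftrightarrow> a' \<le> int j \<and> int j \<le> b'" for j
    using assms(1) by (simp add: set_eq_iff)
  show ?thesis
    using mem[of "nat a"] mem[of "nat b"] mem[of "nat a'"] mem[of "nat b'"] assms by auto
qed

lemma admissible_pos: "admissible n a b c d \<Longrightarrow> 1 \<le> a \<and> 1 \<le> c"
  by (simp add: admissible_def)

lemma two_rows_inj:
  assumes "admissible n a b c d" "admissible n a' b' c' d'" "two_rows a b c d = two_rows a' b' c' d'"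
  shows "a = a' \<and> b = b' \<and> c = c' \<and> d = d'"
proof -
  have mem: "x \<in> two_rows a b c d \<longleftrightarrow> x \<in> two_rows a' b' c' d'" for x using assms(3) by simp
  have row1: "{j. a \<le> int j \<and> int j \<le> b} = {j. a' \<le> int j \<and> int j \<le> b'}"
    using mem[of "(1, _)"] by simp
  have row2: "{j. c \<le> int j \<and> int j \<le> d} = {j. c' \<le> int j \<and> int j \<le> d'}"
    using mem[of "(2, _)"] by simp
  note v = assms(1,2)[unfolded admissible_def]
  have pos: "0 \<le> a" "0 \<le> a'" "0 \<le> c" "0 \<le> c'"
    using admissible_pos[OF assms(1)] admissible_pos[OF assms(2)] by linarith+
  consider "a \<le> b" | "a' \<le> b'" | "a = n + 1" "b = n" "a' = n + 1" "b' = n" using v by blast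
  then have "a = a' \<and> b = b'"
    using interval_inj[OF row1 pos(1,2)] interval_inj[OF row1[symmetric] pos(2,1)] by cases simp_all
  moreover
  consider "c \<le> d" | "c' \<le> d'" | "c = 1" "d = 0" "c' = 1" "d' = 0" using v by blast
  then have "c = c' \<and> d = d'"
    using interval_inj[OF row2 pos(3,4)] interval_inj[OF row2[symmetric] pos(4,3)] by cases simp_all
  ultimately show ?thesis by simp
qed

section \<open>Signed cardinality in terms of endpoints\<close>

lemma finite_nat_interval: "finite {j. a \<le> int j \<and> int j \<le> b}"
  by (rule finite_subset[of _ "{..nat b}"]) auto

text \<open>The signs are those of the first row. Allowing \<open>b = a - 1\<close> covers both
  encodings \<open>(n + 1, n)\<close> and \<open>(1, 0)\<close> of an empty row.\<close>

lemma alternating_sum_interval: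
  assumes "1 \<le> a" "a - 1 \<le> b"
  shows "(\<Sum>j | a \<le> int j \<and> int j \<le> b. if even j then - 1 else (1::int)) = of_bool (odd b) - of_bool (even a)"
  using assms(2)
proof (induction b rule: int_ge_induct)
  case base
  have "{j. a \<le> int j \<and> int j \<le> a - 1} = {}" by auto
  then show ?case by (simp only: sum.empty) simp
next
  case (step b)
  have "{j. a \<le> int j \<and> int j \<le> b + 1} = insert (nat (b + 1)) {j. a \<le> int j \<and> int j \<le> b}"
    using step.hyps assms(1) by auto
  moreover have "nat (b + 1) \<notin> {j. a \<le> int j \<and> int j \<le> b}" using step.hyps assms(1) by auto
  moreover have "even (nat (b + 1)) \<longleftrightarrow> odd b"
    using step.hyps assms(1) by (simp add: even_nat_iff)
  ultimately show ?case using step.IH finite_nat_interval by simp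
qed

definition signed_size :: "int \<Rightarrow> int \<Rightarrow> int \<Rightarrow> int \<Rightarrow> int" where
  "signed_size a b c d = of_bool (odd b) - of_bool (even a) - of_bool (odd d) + of_bool (even c)"

lemma sc_two_rows:
  assumes "admissible n a b c d"
  shows "sc (two_rows a b c d) = signed_size a b c d"
proof -
  let ?A = "{j. a \<le> int j \<and> int j \<le> b}" and ?B = "{j. c \<le> int j \<and> int j \<le> d}"
  have *: "1 \<le> a" "a - 1 \<le> b" "1 \<le> c" "c - 1 \<le> d" using assms by (auto simp: admissible_def)
  have slice: "(\<Sum>x\<in>{i} \<times> C. sc_elem x) = (\<Sum>j\<in>C. sc_elem (i, j))" for i C
  proof -
    have "{i} \<times> C = Pair i ` C" by auto
    then show ?thesis by (simp add: sum.reindex inj_on_def)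
  qed
  have "sc (two_rows a b c d) = (\<Sum>x\<in>{1} \<times> ?A. sc_elem x) + (\<Sum>x\<in>{2} \<times> ?B. sc_elem x)"
    unfolding sc_def two_rows_def
    by (rule sum.union_disjoint) (auto intro: finite_cartesian_product finite_nat_interval)
  also have "(\<Sum>x\<in>{1} \<times> ?A. sc_elem x) = (\<Sum>j\<in>?A. sc_elem (1, j))"
    by (rule slice)
  \<comment> \<open>At \<open>j = 0\<close> the subtraction in \<open>rank\<close> would truncate;
    \<open>1 \<le> a\<close> excludes this.\<close>
  also have "\<dots> = (\<Sum>j\<in>?A. if even j then - 1 else 1)"
    using *(1) by (intro sum.cong) (auto simp: sc_elem_def rank_def)
  also have "(\<Sum>x\<in>{2} \<times> ?B. sc_elem x) = (\<Sum>j\<in>?B. sc_elem (2, j))"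
    by (rule slice)
  also have "\<dots> = - (\<Sum>j\<in>?B. if even j then - 1 else 1)"
    unfolding sum_negf[symmetric] by (intro sum.cong) (auto simp: sc_elem_def rank_def)
  finally show ?thesis
    unfolding alternating_sum_interval[OF *(1,2)] alternating_sum_interval[OF *(3,4)]
    by (simp add: signed_size_def)
qed

subsection \<open>Rowmotion in terms of endpoints\<close>

text \<open>Rowmotion first sweeps the second row from right to left, then the first row.\<close>

definition upper_step :: "int \<Rightarrow> int \<Rightarrow> int \<Rightarrow> int \<Rightarrow> int \<Rightarrow> int \<times> int" where
  "upper_step n a b c d =
     (if c > d then (1, if a > b then n else a)
      else if d < b then (if c < a then (c + 1, d + 1) else (1, d + 1))
      else (1, c - 1))"

text \<open>Here \<open>[a, b]\<close> is the first row before its sweep, but \<open>[c, d]\<close>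
  is the second row after its own: the first row is toggled against the new elements above
  it.\<close>

definition lower_step :: "int \<Rightarrow> int \<Rightarrow> int \<Rightarrow> int \<Rightarrow> int \<Rightarrow> int \<times> int" where
  "lower_step n a b c d =
     (if a > b then (if c > d then 1 else c, n)
      else if b < n then (a + 1, b + 1)
      else if c > d then (if a = 1 then (n + 1, n) else (1, a - 1))
      else if a < d then (a + 1, d)
      else if a = d then (n + 1, n)
      else (c, a - 1))"

lemma upper_step_admissible:
  assumes "admissible n a b c d" "n \<ge> 1" "upper_step n a b c d = (c', d')"
  shows "admissible n a b c' d'"
  using assms by (auto simp: admissible_def upper_step_def split: if_splits)

lemma lower_step_admissible:
  assumes "admissible n a b c d" "n \<ge> 1" "lower_step n a b c d = (a', b')"
  shows "admissible n a' b' c d"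
  using assms by (auto simp: admissible_def lower_step_def split: if_splits)

text \<open>The existentials in \<open>blocked\<close> have extremal witnesses: an endpoint of a
  row, and a gap right next to \<open>(2, j)\<close>. Being blocked thus becomes linear arithmetic
  on endpoints.\<close>

lemma blocked_row2:
  assumes I: "admissible (int n) a b c d" and J: "admissible (int n) a' b' c' d'" and j: "1 \<le> j" "j \<le> n"
  shows "blocked (two_by n) (two_rows a b c d) (two_rows a' b' c' d') (2, j) \<longleftrightarrow>
    (if c \<le> int j \<and> int j \<le> d then (a \<le> b \<and> a \<le> int j \<or> c < int j) \<and> (c' \<le> d' \<and> int j < d')
     else c' \<le> d' \<and> int j + 1 < c' \<or> a \<le> b \<and> b < int j \<or> c \<le> d \<and> d + 1 < int j \<or>
          a \<le> b \<and> a < int j \<and> d + 1 < int j)"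
proof -
  note v = I[unfolded admissible_def] J[unfolded admissible_def]
  have up1: "(\<exists>y\<in>two_rows a' b' c' d'. (2, j) < y) \<longleftrightarrow> c' \<le> d' \<and> int j < d'" (is "?L \<longleftrightarrow> ?R")
  proof
    assume ?R then show ?L using v by (intro bexI[of _ "(2, nat d')"]) auto
  qed auto
  have down1: "(\<exists>y\<in>two_rows a b c d. y < (2, j)) \<longleftrightarrow> (a \<le> b \<and> a \<le> int j \<or> c \<le> d \<and> c < int j)" (is "?L \<longleftrightarrow> ?R")
  proof
    assume ?R
    then show ?L
    proof
      assume "a \<le> b \<and> a \<le> int j" then show ?L using v by (intro bexI[of _ "(1, nat a)"]) auto
    next
      assume "c \<le> d \<and> c < int j" then show ?L using v by (intro bexI[of _ "(2, nat c)"]) auto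
    qed
  qed auto
  have up2: "(\<exists>y\<in>two_rows a' b' c' d'. \<exists>z\<in>two_by n. (2, j) < z \<and> z < y \<and> z \<notin> two_rows a' b' c' d') \<longleftrightarrow>
      c' \<le> d' \<and> int j + 1 < c'" (is "?L \<longleftrightarrow> ?R")
  proof
    assume ?R
    then show ?L using v
      by (intro bexI[of _ "(2, nat c')"] bexI[of _ "(2, Suc j)"]) auto
  qed auto
  have down2: "(\<exists>y\<in>two_rows a b c d. \<exists>z\<in>two_by n. y < z \<and> z < (2, j) \<and> z \<notin> two_rows a b c d) \<longleftrightarrow>
      a \<le> b \<and> b < int j \<or> c \<le> d \<and> d + 1 < int j \<or> a \<le> b \<and> a < int j \<and> d + 1 < int j"
    (is "?L \<longleftrightarrow> ?R") if "\<not> (c \<le> int j \<and> int j \<le> d)"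
  proof
    assume ?R
    then show ?L
    proof (elim disjE)
      assume "a \<le> b \<and> b < int j"
      then show ?L using v j by (intro bexI[of _ "(1, nat b)"] bexI[of _ "(1, j)"]) auto
    next
      assume "c \<le> d \<and> d + 1 < int j"
      then show ?L using v j by (intro bexI[of _ "(2, nat d)"] bexI[of _ "(2, j - 1)"]) auto
    next
      assume "a \<le> b \<and> a < int j \<and> d + 1 < int j"
      then show ?L using v j by (intro bexI[of _ "(1, nat a)"] bexI[of _ "(2, j - 1)"]) auto
    qed
  next
    assume ?L
    then obtain u w where uw: "u \<in> two_rows a b c d" "w \<in> two_by n" "u < w" "w < (2, j)" "w \<notin> two_rows a b c d"
      by blast
    obtain i k p q where eq: "u = (i, k)" "w = (p, q)" by (cases u, cases w)
    have y: "(i, k) \<in> two_rows a b c d" and z: "(p, q) \<in> two_by n" "(p, q) \<notin> two_rows a b c d"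
      and less: "(i, k) < (p, q)" "(p, q) < (2, j)" using uw unfolding eq by blast+
    have kq: "int k \<le> int q" "int q \<le> int j" "int k < int q \<or> i \<noteq> p" "int q < int j \<or> p \<noteq> 2"
      using less by auto
    have rows: "i = 1 \<or> i = 2" "p = 1 \<or> p = 2" "i \<le> p" using y z less by auto
    consider "i = 1" "p = 1" | "i = 1" "p = 2" | "i = 2" "p = 2" using rows by fastforce
    then show ?R
    proof cases
      case 1
      with y z kq have "a \<le> b" "b < int j" by auto
      then show ?thesis by blast
    next
      case 2
      moreover have "c \<le> a" using v by blast
      ultimately have "a \<le> b" "a < int j" "d < int q" "int q < int j" using y z kq by auto
      then show ?thesis by linarith
    next
      case 3
      with y z kq have "c \<le> d" "d < int q" "int q < int j" by auto
      then show ?thesis by linarith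
    qed
  qed
  show ?thesis unfolding blocked_def using up1 down1 up2 down2 by auto
qed

text \<open>The gap conditions mirror those of \<open>blocked_row2\<close> under reversing the order
  and exchanging the rows, with the roles of old and new set swapped.\<close>

lemma blocked_row1:
  assumes I: "admissible (int n) a b c d" and J: "admissible (int n) a' b' c' d'" and j: "1 \<le> j" "j \<le> n"
  shows "blocked (two_by n) (two_rows a b c d) (two_rows a' b' c' d') (1, j) \<longleftrightarrow>
    (if a \<le> int j \<and> int j \<le> b then
       a < int j \<and> (a' \<le> b' \<and> int j < b' \<or> c' \<le> d' \<and> int j \<le> d')
     else a' \<le> b' \<and> int j + 1 < a' \<or> c' \<le> d' \<and> int j < d' \<and> int j + 1 < a' \<or>
          c' \<le> d' \<and> int j < c' \<or> a \<le> b \<and> b + 1 < int j)"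
proof -
  note v = I[unfolded admissible_def] J[unfolded admissible_def]
  have up1: "(\<exists>y\<in>two_rows a' b' c' d'. (1, j) < y) \<longleftrightarrow> a' \<le> b' \<and> int j < b' \<or> c' \<le> d' \<and> int j \<le> d'"
    (is "?L \<longleftrightarrow> ?R")
  proof
    assume ?R
    then show ?L
    proof
      assume "a' \<le> b' \<and> int j < b'" then show ?L using v by (intro bexI[of _ "(1, nat b')"]) auto
    next
      assume "c' \<le> d' \<and> int j \<le> d'" then show ?L using v by (intro bexI[of _ "(2, nat d')"]) auto
    qed
  qed auto
  have down1: "(\<exists>y\<in>two_rows a b c d. y < (1, j)) \<longleftrightarrow> a \<le> b \<and> a < int j" (is "?L \<longleftrightarrow> ?R")
  proof
    assume ?R then show ?L using v by (intro bexI[of _ "(1, nat a)"]) auto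
  qed auto
  have up2: "(\<exists>y\<in>two_rows a' b' c' d'. \<exists>z\<in>two_by n. (1, j) < z \<and> z < y \<and> z \<notin> two_rows a' b' c' d') \<longleftrightarrow>
      a' \<le> b' \<and> int j + 1 < a' \<or> c' \<le> d' \<and> int j < d' \<and> int j + 1 < a' \<or> c' \<le> d' \<and> int j < c'"
    (is "?L \<longleftrightarrow> ?R")
  proof
    assume ?R
    then show ?L
    proof (elim disjE)
      assume "a' \<le> b' \<and> int j + 1 < a'"
      then show ?L using v by (intro bexI[of _ "(1, nat a')"] bexI[of _ "(1, Suc j)"]) auto
    next
      assume "c' \<le> d' \<and> int j < d' \<and> int j + 1 < a'"
      then show ?L using v by (intro bexI[of _ "(2, nat d')"] bexI[of _ "(1, Suc j)"]) auto
    next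
      assume "c' \<le> d' \<and> int j < c'"
      then show ?L using v j by (intro bexI[of _ "(2, nat c')"] bexI[of _ "(2, j)"]) auto
    qed
  next
    assume ?L
    then obtain u w where uw: "u \<in> two_rows a' b' c' d'" "w \<in> two_by n" "(1, j) < w" "w < u" "w \<notin> two_rows a' b' c' d'"
      by blast
    obtain i k p q where eq: "u = (i, k)" "w = (p, q)" by (cases u, cases w)
    have y: "(i, k) \<in> two_rows a' b' c' d'" and z: "(p, q) \<in> two_by n" "(p, q) \<notin> two_rows a' b' c' d'"
      and less: "(1, j) < (p, q)" "(p, q) < (i, k)" using uw unfolding eq by blast+
    have kq: "int j \<le> int q" "int q \<le> int k" "int q < int k \<or> i \<noteq> p" "int j < int q \<or> p \<noteq> 1"
      using less by auto
    have rows: "i = 1 \<or> i = 2" "p = 1 \<or> p = 2" "p \<le> i" using y z less by auto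
    consider "i = 1" "p = 1" | "i = 2" "p = 1" | "i = 2" "p = 2" using rows by fastforce
    then show ?R
    proof cases
      case 1
      with y z kq have "a' \<le> b'" "int q < a'" "int j < int q" by auto
      then show ?thesis by linarith
    next
      case 2
      moreover have "d' \<le> b'" using v by blast
      ultimately have "c' \<le> d'" "int j < int q" "int q < a'" "int q \<le> d'" using y z kq by auto
      then show ?thesis by linarith
    next
      case 3
      with y z kq have "c' \<le> d'" "int q < c'" by auto
      then show ?thesis using kq by linarith
    qed
  qed
  have down2: "(\<exists>y\<in>two_rows a b c d. \<exists>z\<in>two_by n. y < z \<and> z < (1, j) \<and> z \<notin> two_rows a b c d) \<longleftrightarrow>
      a \<le> b \<and> b + 1 < int j" (is "?L \<longleftrightarrow> ?R")
  proof
    assume ?R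
    then show ?L using v j by (intro bexI[of _ "(1, nat b)"] bexI[of _ "(1, j - 1)"]) auto
  qed auto
  show ?thesis unfolding blocked_def using up1 down1 up2 down2 by auto
qed

text \<open>The new endpoints solve the equation of \<open>rowmotion_eqI\<close> at every element;
  once \<open>blocked\<close> is expressed by endpoints this is a case check in linear
  arithmetic.\<close>

lemma rowmotion_two_rows:
  assumes ext: "linear_extension (two_by n) xs" and "n \<ge> 1" and v: "admissible (int n) a b c d"
    and R2: "upper_step (int n) a b c d = (c', d')" and R1: "lower_step (int n) a b c' d' = (a', b')"
  shows "rowmotion (two_by n) xs (two_rows a b c d) = two_rows a' b' c' d'"
proof (rule rowmotion_eqI[OF ext two_rows_closed[OF v]])
  have v2: "admissible (int n) a b c' d'" using upper_step_admissible[OF v _ R2] \<open>n \<ge> 1\<close> by simp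
  have v': "admissible (int n) a' b' c' d'" using lower_step_admissible[OF v2 _ R1] \<open>n \<ge> 1\<close> by simp
  show "two_rows a' b' c' d' \<subseteq> two_by n" using two_rows_subset[OF v'] .
  fix x assume x: "x \<in> two_by n"
  obtain i j where ij: "x = (i, j)" "i = 1 \<or> i = 2" "1 \<le> j" "j \<le> n" using x by (cases x) auto
  have j: "1 \<le> int j" "int j \<le> int n" using ij by auto
  from ij(2) show "x \<in> two_rows a' b' c' d' \<longleftrightarrow> (x \<in> two_rows a b c d \<longleftrightarrow> blocked (two_by n) (two_rows a b c d) (two_rows a' b' c' d') x)"
  proof
    assume i: "i = 1"
    show ?thesis
      unfolding ij(1) i blocked_row1[OF v v' ij(3,4)]
      using R1 v v2 j unfolding admissible_def lower_step_def
      by (auto split: if_splits)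
  next
    assume i: "i = 2"
    show ?thesis
      unfolding ij(1) i blocked_row2[OF v v' ij(3,4)]
      using R2 v j unfolding admissible_def upper_step_def
      by (auto split: if_splits)
  qed
qed

subsection \<open>The potential\<close>

definition shift :: "int \<Rightarrow> int" where
  "shift n = (if n mod 6 = 5 then 2 else 0)"

lemma shift_cases: "shift n = 0 \<or> shift n = 2"
  by (simp add: shift_def)

text \<open>For odd \<open>n\<close>, the numbers \<open>n - 1\<close> and \<open>n + 1\<close> lie
  in the same block of six unless \<open>n mod 6 = 5\<close>, and then adding 2 to both repairs
  this. Used in \<open>phi_1\<close> and \<open>phi_3\<close> when the middle entry is small again
  after the return.\<close>

lemma shift_div:
  assumes "odd n"
  shows "(n + 1 + shift n) div 6 = (n - 1 + shift n) div 6"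
proof -
  have "n mod 6 = 1 \<or> n mod 6 = 3 \<or> n mod 6 = 5" using assms by presburger
  then obtain m where "n = 6 * m + 1 \<or> n = 6 * m + 3 \<or> n = 6 * m + 5"
    by (metis mult_div_mod_eq)
  then show ?thesis unfolding shift_def by (elim disjE) (simp; presburger)+
qed

text \<open>For \<open>y \<in> {1, 3}\<close> exactly one of \<open>x\<close> and \<open>z\<close> is even, and two consecutive boundary steps move it by 6,
so a quotient by 6 counts these steps. The same holds with \<open>x \<in> {1, 3}\<close> and the pair \<open>y\<close>, \<open>z\<close>. The offset
\<open>shift n\<close> makes the two counts agree where \<open>x\<close> and \<open>y\<close> are both small.\<close>

definition phi :: "int \<Rightarrow> int \<Rightarrow> int \<Rightarrow> int \<Rightarrow> int" where
  "phi n x y z =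
     (if y \<le> 3 then (if y = 2 then 0 else ((if even x then x else z) - y + 1 + shift n) div 6)
      else if x \<le> 3 then (if x = 2 then 0 else ((if even y then y else z) - x + 1 + shift n) div 6)
      else 0)"

text \<open>This is the uncorrected return from \<open>(x, y, z)\<close> to
  \<open>(z, x, y)\<close>. If \<open>x\<close> is 1 or 3, exactly one of \<open>y\<close> and
  \<open>z\<close> is even and both sides use that entry; otherwise both sides vanish.\<close>

lemma phi_rotate:
  assumes "odd n" "x + y + z = n + 5" "x \<ge> 1" "y \<ge> 4" "z \<ge> 4"
  shows "phi n z x y = phi n x y z"
proof -
  have *: "x = 1 \<or> x = 2 \<or> x = 3 \<or> x \<ge> 4" using assms by arith
  have "even x \<or> (even y \<longleftrightarrow> odd z)" using assms(1,2) by presburger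
  with * assms show ?thesis unfolding phi_def by auto
qed

text \<open>If the first row has one element, the second row ends at \<open>n\<close> by the time
  the first becomes empty, and the triple returns as \<open>(3, z - 4, x + 2)\<close>. The cases ask
  whether \<open>z - 4\<close> is again at most 3.\<close>

lemma phi_1:
  assumes "odd n" "x + 1 + z = n + 5" "x \<ge> 2" "z \<ge> 5"
  shows "phi n 3 (z - 4) (x + 2) = phi n x 1 z - of_bool (odd x)"
proof -
  consider "z = 5" "x = n - 1" | "z = 6" "x = n - 2" | "z = 7" "x = n - 3" | "z \<ge> 8" using assms by linarith
  then show ?thesis
  proof cases
    case 1 then show ?thesis using shift_div[OF assms(1)] assms(1) by (simp add: phi_def)
  next
    case 2 then show ?thesis using shift_cases[of n] assms(1) by (auto simp: phi_def)
  next
    case 3 then show ?thesis using assms(1) by (simp add: phi_def)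
  next
    case 4
    have "even x \<longleftrightarrow> odd z" using assms(1,2) by presburger
    moreover have "(z - 6 + shift n) div 6 = (z + shift n) div 6 - 1"
      using div_add_self1[of 6 "z - 6 + shift n"] by simp
    ultimately show ?thesis using 4 by (auto simp: phi_def algebra_simps)
  qed
qed

text \<open>A first row of two elements returns as \<open>(2, z - 3, x + 3)\<close>. The value 0 is
  also that before the return, since \<open>phi\<close> vanishes at middle entry 2.\<close>

lemma phi_2:
  assumes "odd n" "x + 2 + z = n + 5" "x \<ge> 1" "z \<ge> 4"
  shows "phi n 2 (z - 3) (x + 3) = 0"
proof -
  consider "z = 4" | "z = 5" | "z = 6" | "z \<ge> 7" using assms by linarith
  then show ?thesis using shift_cases[of n] by cases (auto simp: phi_def)
qed

text \<open>A first row of three elements returns as \<open>(1, z - 2, x + 4)\<close>. The cases ask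
  whether \<open>z - 2\<close> is 2, 3 or larger.\<close>

lemma phi_3:
  assumes "odd n" "x + 3 + z = n + 5" "x \<ge> 1" "z \<ge> 4"
  shows "phi n 1 (z - 2) (x + 4) = phi n x 3 z + of_bool (even x)"
proof -
  consider "z = 4" "x = n - 2" | "z = 5" "x = n - 3" | "z \<ge> 6" using assms by linarith
  then show ?thesis
  proof cases
    case 1 then show ?thesis using shift_cases[of n] assms(1) by (auto simp: phi_def)
  next
    case 2
    have "(n - 5 + shift n) div 6 = (n + 1 + shift n) div 6 - 1"
      using div_add_self1[of 6 "n - 5 + shift n"] by (simp add: algebra_simps)
    then show ?thesis unfolding 2 using shift_div[OF assms(1)] assms(1) by (simp add: phi_def algebra_simps)
  next
    case 3
    have "even x \<longleftrightarrow> odd z" using assms(1,2) by presburger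
    moreover have "(x + 4 + shift n) div 6 = (x - 2 + shift n) div 6 + 1"
      using div_add_self1[of 6 "x - 2 + shift n"] by (simp add: algebra_simps)
    ultimately show ?thesis using 3 by (auto simp: phi_def algebra_simps)
  qed
qed

text \<open>When only the second row is empty, \<open>n - b + 1\<close> steps empty the first row.
  If that row had at least four elements, three more steps empty the second row, and the first row
  then starts at \<open>n - b + 4\<close>; this is the last entry of the triple. The entries add up
  to \<open>n + 5\<close>.\<close>

definition phi_interval :: "int \<Rightarrow> int \<Rightarrow> int \<Rightarrow> int" where
  "phi_interval n a b = phi n a (b - a + 1) (n - b + 4)"

text \<open>The cases are, in this order: both rows empty or full, second row empty, first row empty, the sets
met between an empty second row and an empty first row (\<open>d = a - 1\<close>), those met between an empty first
row and an empty second row (two cases), and the orbits without empty rows.\<close>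

definition pot :: "int \<Rightarrow> int \<Rightarrow> int \<Rightarrow> int \<Rightarrow> int \<Rightarrow> int" where
  "pot n a b c d =
     (if a > b \<and> c > d \<or> a = 1 \<and> c = 1 \<and> d = n then 0
      else if c > d then phi_interval n a b - of_bool (odd a \<and> odd b)
      else if a > b then phi_interval n (d - c + 1) (n + 1 - c) - of_bool (even c \<and> even d)
      else if d = a - 1 then
        phi_interval n (a - c) (b - c) - of_bool (odd a \<and> (even c \<or> odd b)) - of_bool (odd a \<and> even c \<and> odd b)
      else if a = c \<and> b = n then
        (if c = 1 then phi_interval n (n - d) (n - d) - of_bool (even d)
         else phi_interval n (d - c + 1) (n + 2 - c) - of_bool (even c \<and> even d))
      else if c = 1 \<and> b = d then
        (if b < n then phi_interval n (a + 1) (b + 1) + of_bool (even a \<and> odd b) else phi_interval n 1 (a - 1))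
      else if a \<le> d then - of_bool (even c \<and> odd a) - of_bool (even d \<and> odd b)
      else - of_bool (even c \<and> odd b) - of_bool (even d \<and> odd a))"

text \<open>The return excluded from \<open>phi_1\<close> by \<open>z \<ge> 5\<close>: a full second
  row alone is followed at once by a full first row alone, so \<open>(n, 1, 4)\<close> returns as
  \<open>(1, n, 4)\<close>.\<close>

lemma phi_exceptional:
  assumes "odd n" "n \<ge> 1"
  shows "phi n 1 n 4 = phi n n 1 4"
proof -
  have "n = 1 \<or> n = 3 \<or> n > 3" using assms by presburger
  then consider "n = 1" | "n = 3" | "n > 3" by blast
  then show ?thesis using assms by cases (auto simp: phi_def shift_def)
qed

text \<open>On orbits meeting sets where only the second row is empty, \<open>pot\<close> evaluates
  \<open>phi_interval\<close> at the last such set, but once \<open>c = 1\<close> and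
  \<open>b = d\<close> at the next one. So the argument of \<open>phi\<close> changes only on
  entering that stage, or in the jump of \<open>phi_exceptional\<close>; all other steps are parity
  checks.\<close>

lemma pot_step:
  assumes "odd n" and admissible: "admissible n a b c d"
    and R2: "upper_step n a b c d = (c', d')" and R1: "lower_step n a b c' d' = (a', b')"
  shows "pot n a' b' c' d' - pot n a b c d = signed_size a b c d"
proof -
  note defs = lower_step_def upper_step_def
  have *: "1 \<le> c" "c \<le> a" "d \<le> b" "b \<le> n" "c \<le> d \<or> c = 1 \<and> d = 0" "a \<le> b \<or> a = n + 1 \<and> b = n"
    using admissible by (auto simp: admissible_def)
  consider (empty) "a = n + 1" "b = n" "c = 1" "d = 0"
    | (full) "a = 1" "c = 1" "b = n" "d = n" "n \<ge> 1"
    | (upper_empty) "a \<le> b" "c = 1" "d = 0"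
    | (lower_empty) "a = n + 1" "b = n" "c \<le> d"
    | (adjacent) "a \<le> b" "c \<le> d" "d = a - 1"
    | (same_start_1) "a = 1" "c = 1" "b = n" "d \<ge> 1" "d < n"
    | (same_start) "a = c" "b = n" "c > 1" "c \<le> d"
    | (same_end) "c = 1" "b = d" "1 \<le> a" "a \<le> b" "a = 1 \<longrightarrow> b < n"
    | (generic) "a \<le> b" "c \<le> d" "d \<noteq> a - 1" "\<not> (a = c \<and> b = n)" "\<not> (c = 1 \<and> b = d)"
    using * by (smt (verit))
  then show ?thesis
  proof cases
    case empty
    with * have "c' = 1" "d' = n" "a' = 1" "b' = n" using R1 R2 by (auto simp: defs split: if_splits)
    then show ?thesis using empty \<open>odd n\<close> by (simp add: pot_def signed_size_def algebra_simps)
  next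
    case full
    with * have "c' = 1" "d' = 0" "a' = n + 1" "b' = n" using R1 R2 by (auto simp: defs split: if_splits)
    then show ?thesis using full \<open>odd n\<close> by (simp add: pot_def signed_size_def algebra_simps)
  next
    case upper_empty
    have r2: "c' = 1" "d' = a" using R2 upper_empty by (auto simp: defs)
    show ?thesis
    proof (cases "b < n")
      case True
      then have "a' = a + 1" "b' = b + 1" using R1 r2 upper_empty * by (auto simp: defs)
      then show ?thesis using upper_empty r2 True * by (auto simp: pot_def signed_size_def algebra_simps)
    next
      case False
      then have "a' = n + 1" "b' = n" using R1 r2 upper_empty * by (auto simp: defs)
      then show ?thesis using upper_empty r2 False \<open>odd n\<close> * by (auto simp: pot_def signed_size_def algebra_simps)
    qed
  next
    case lower_empty
    consider "d < n" | "d = n" "c > 1" | "d = n" "c = 1" using lower_empty * by force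
    then show ?thesis
    proof cases
      case 1
      then have "c' = c + 1" "d' = d + 1" "a' = c + 1" "b' = n" using R1 R2 lower_empty * by (auto simp: defs)
      then show ?thesis using lower_empty 1 \<open>odd n\<close> * by (auto simp: pot_def signed_size_def algebra_simps)
    next
      case 2
      then have "c' = 1" "d' = c - 1" "a' = 1" "b' = n" using R1 R2 lower_empty * by (auto simp: defs)
      then show ?thesis using lower_empty 2 \<open>odd n\<close> * by (auto simp: pot_def signed_size_def algebra_simps)
    next
      case 3
      then have "c' = 1" "d' = 0" "a' = 1" "b' = n" using R1 R2 lower_empty * by (auto simp: defs)
      then show ?thesis using lower_empty 3 \<open>odd n\<close> * phi_exceptional[of n]
        by (auto simp: pot_def signed_size_def phi_interval_def)
    qed
  next
    case adjacent
    have r2: "c' = c + 1" "d' = a" using R2 adjacent * by (auto simp: defs)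
    show ?thesis
    proof (cases "b < n")
      case True
      then have "a' = a + 1" "b' = b + 1" using R1 r2 adjacent * by (auto simp: defs)
      then show ?thesis using adjacent r2 True * by (auto simp: pot_def signed_size_def algebra_simps)
    next
      case False
      then have "a' = n + 1" "b' = n" using R1 r2 adjacent * by (auto simp: defs)
      then show ?thesis using adjacent r2 False \<open>odd n\<close> * by (auto simp: pot_def signed_size_def algebra_simps)
    qed
  next
    case same_start_1
    then have r: "c' = 1" "d' = d + 1" "a' = 2" "b' = d + 1" using R1 R2 by (auto simp: defs)
    show ?thesis
    proof (cases "d + 1 < n")
      case True
      \<comment> \<open>The last set with empty second row had the triple
        \<open>(n - d, 1, d + 4)\<close>.\<close>
      have "phi_interval n 3 (d + 2) = phi_interval n (n - d) (n - d) - of_bool (even d)"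
        using phi_1[of n "n - d" "d + 4"] True same_start_1 \<open>odd n\<close> by (simp add: phi_interval_def algebra_simps)
      then show ?thesis using same_start_1 r True \<open>odd n\<close> by (auto simp: pot_def signed_size_def algebra_simps)
    next
      case False
      \<comment> \<open>Here the triple \<open>(1, 1, n + 3)\<close> returns to itself, so
        \<open>phi\<close> does not change.\<close>
      then have "n = d + 1" using same_start_1 by simp
      then show ?thesis using same_start_1 r \<open>odd n\<close> by (auto simp: pot_def signed_size_def algebra_simps)
    qed
  next
    case same_start
    \<comment> \<open>These are the returns with middle entry at least 4, equal to 3 and equal to
      2.\<close>
    consider "d < n - 1" | "d = n - 1" | "d = n" using same_start * by force
    then show ?thesis
    proof cases
      case 1
      then have r: "c' = 1" "d' = d + 1" "a' = c + 1" "b' = d + 1" using R1 R2 same_start by (auto simp: defs)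
      have "phi_interval n (c + 2) (d + 2) = phi_interval n (d - c + 1) (n + 2 - c)"
        using phi_rotate[of n "d - c + 1" "n + 2 - d" "c + 2"] 1 same_start \<open>odd n\<close>
        by (simp add: phi_interval_def algebra_simps)
      then show ?thesis using same_start r 1 \<open>odd n\<close> by (auto simp: pot_def signed_size_def algebra_simps)
    next
      case 2
      then have r: "c' = 1" "d' = n" "a' = c + 1" "b' = n" using R1 R2 same_start by (auto simp: defs)
      have "phi_interval n 1 c = phi_interval n (n - c) (n + 2 - c) + of_bool (odd c)"
        using phi_3[of n "n - c" "c + 2"] 2 same_start \<open>odd n\<close> by (simp add: phi_interval_def algebra_simps)
      then show ?thesis using same_start r 2 \<open>odd n\<close> by (auto simp: pot_def signed_size_def algebra_simps)
    next
      case 3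
      then have r: "c' = 1" "d' = c - 1" "a' = 1" "b' = c - 1" using R1 R2 same_start by (auto simp: defs)
      have "phi_interval n 2 c = 0"
        using phi_2[of n "n - c + 1" "c + 2"] 3 same_start \<open>odd n\<close> by (simp add: phi_interval_def algebra_simps)
      moreover have "phi_interval n (n - c + 1) (n + 2 - c) = 0" by (simp add: phi_interval_def phi_def)
      ultimately show ?thesis using same_start r 3 \<open>odd n\<close> by (auto simp: pot_def signed_size_def algebra_simps)
    qed
  next
    case same_end
    have r2: "c' = 1" "d' = 0" using R2 same_end by (auto simp: defs)
    show ?thesis
    proof (cases "b < n")
      case True
      then have "a' = a + 1" "b' = b + 1" using R1 r2 same_end * by (auto simp: defs)
      then show ?thesis using same_end r2 True * by (auto simp: pot_def signed_size_def algebra_simps)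
    next
      case False
      then have "a' = 1" "b' = a - 1" using R1 r2 same_end * by (auto simp: defs)
      then show ?thesis using same_end r2 False \<open>odd n\<close> * by (auto simp: pot_def signed_size_def algebra_simps)
    qed
  next
    case generic
    \<comment> \<open>The first digit is the branch of \<open>upper_step\<close> for a nonempty
      second row: shift, \<open>c = a\<close>, or \<open>d = b\<close>. The second digit means
      \<open>b < n\<close>, or \<open>b = n\<close> with \<open>a\<close> below (2) or above (3) the
      new endpoint \<open>d'\<close>.\<close>
    consider (11) "d < b" "c < a" "b < n" | (12) "d < b" "c < a" "b = n" "a \<le> d"
      | (13) "d < b" "c < a" "b = n" "d < a - 1" | (21) "d < b" "c = a" "b < n"
      | (31) "d = b" "b < n" | (33) "d = b" "b = n" "c < a"
      using generic * by (smt (verit))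
    then show ?thesis
    proof cases
      case 11
      then have r: "c' = c + 1" "d' = d + 1" "a' = a + 1" "b' = b + 1" using R1 R2 generic * by (auto simp: defs)
      \<comment> \<open>All parities flip. With truth values in brackets, [c even, a odd] -
        [c odd, a even] = [c even] - [a even], and \<open>d\<close>, \<open>b\<close> contribute
        [b odd] - [d odd]. Pairing \<open>c\<close> with \<open>b\<close> and \<open>d\<close> with
        \<open>a\<close>, as for \<open>a > d\<close>, gives the same total.\<close>
      show ?thesis unfolding r using 11 generic * by (auto simp: pot_def signed_size_def algebra_simps)
    next
      case 12
      then have r: "c' = c + 1" "d' = d + 1" "a' = a + 1" "b' = d + 1" using R1 R2 generic * by (auto simp: defs)
      show ?thesis unfolding r using 12 generic * \<open>odd n\<close> by (auto simp: pot_def signed_size_def algebra_simps)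
    next
      case 13
      \<comment> \<open>The set passes from \<open>a > d\<close> to \<open>a \<le> d\<close>, so the
        pairing of endpoints in \<open>pot\<close> changes; case 31 changes it back.\<close>
      then have r: "c' = c + 1" "d' = d + 1" "a' = c + 1" "b' = a - 1" using R1 R2 generic * by (auto simp: defs)
      show ?thesis unfolding r using 13 generic * \<open>odd n\<close> by (auto simp: pot_def signed_size_def algebra_simps)
    next
      case 21
      then have r: "c' = 1" "d' = d + 1" "a' = a + 1" "b' = b + 1" using R1 R2 generic * by (auto simp: defs)
      show ?thesis unfolding r using 21 generic * by (auto simp: pot_def signed_size_def algebra_simps)
    next
      case 31
      then have r: "c' = 1" "d' = c - 1" "a' = a + 1" "b' = b + 1" using R1 R2 generic * by (auto simp: defs)
      show ?thesis unfolding r using 31 generic * by (auto simp: pot_def signed_size_def algebra_simps)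
    next
      case 33
      then have r: "c' = 1" "d' = c - 1" "a' = 1" "b' = a - 1" using R1 R2 generic * by (auto simp: defs)
      show ?thesis unfolding r using 33 generic * \<open>odd n\<close> by (auto simp: pot_def signed_size_def algebra_simps)
    qed
  qed
qed

text \<open>Well defined because the admissible endpoints of a set are unique by
  \<open>two_rows_inj\<close>.\<close>

definition pot_set :: "nat \<Rightarrow> (nat \<times> nat) set \<Rightarrow> int" where
  "pot_set n I = (THE p. \<exists>a b c d. admissible (int n) a b c d \<and> I = two_rows a b c d \<and> p = pot (int n) a b c d)"

lemma pot_set_two_rows:
  assumes "admissible (int n) a b c d"
  shows "pot_set n (two_rows a b c d) = pot (int n) a b c d"
  unfolding pot_set_def
proof (rule the_equality)
  show "\<exists>a' b' c' d'. admissible (int n) a' b' c' d' \<and> two_rows a b c d = two_rows a' b' c' d' \<and>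
      pot (int n) a b c d = pot (int n) a' b' c' d'"
    using assms by blast
next
  fix p
  assume "\<exists>a' b' c' d'. admissible (int n) a' b' c' d' \<and> two_rows a b c d = two_rows a' b' c' d' \<and> p = pot (int n) a' b' c' d'"
  then show "p = pot (int n) a b c d" using two_rows_inj[OF assms] by metis
qed

theorem theorem1p3:
  fixes n :: nat and xs :: "(nat \<times> nat) list"
  assumes "odd n"
    and "linear_extension (two_by n) xs"
  shows "homomesic (interval_closed_sets (two_by n)) (rowmotion (two_by n) xs)
           (\<lambda>I. real_of_int (sc I)) 0"
proof (rule homomesic_zero_if_coboundary[where pot = "\<lambda>I. real_of_int (pot_set n I)"])
  have "interval_closed_sets (two_by n) \<subseteq> Pow (two_by n)"
    by (auto simp: interval_closed_sets_def)
  then show "finite (interval_closed_sets (two_by n))"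
    by (rule finite_subset) (simp add: two_by_def)
  show "inj_on (rowmotion (two_by n) xs) (interval_closed_sets (two_by n))"
    unfolding rowmotion_def by (rule inj_on_foldr_toggle)
  show "rowmotion (two_by n) xs ` interval_closed_sets (two_by n) \<subseteq> interval_closed_sets (two_by n)"
    by (auto simp: rowmotion_def intro: foldr_toggle_closed)
next
  fix I assume "I \<in> interval_closed_sets (two_by n)"
  then obtain a b c d where v: "admissible (int n) a b c d" and I: "I = two_rows a b c d"
    by (rule interval_closed_set_is_two_rows)
  obtain c' d' where R2: "upper_step (int n) a b c d = (c', d')" by fastforce
  obtain a' b' where R1: "lower_step (int n) a b c' d' = (a', b')" by fastforce
  have n: "n \<ge> 1" "odd (int n)" using assms(1) by (simp_all add: odd_pos Suc_leI)
  then have v': "admissible (int n) a' b' c' d'"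
    using lower_step_admissible[OF upper_step_admissible[OF v _ R2] _ R1] by simp
  have "rowmotion (two_by n) xs I = two_rows a' b' c' d'"
    unfolding I by (rule rowmotion_two_rows[OF assms(2) n(1) v R2 R1])
  then have "pot_set n (rowmotion (two_by n) xs I) - pot_set n I = sc I"
    using pot_step[OF n(2) v R2 R1] by (simp add: I pot_set_two_rows v v' sc_two_rows[OF v])
  then show "real_of_int (sc I) =
      real_of_int (pot_set n (rowmotion (two_by n) xs I)) - real_of_int (pot_set n I)"
    by (metis of_int_diff)
qed

end
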